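(* Let $\mathrm{Bu}=\beta(B_3)$ and $\Delta=(\sigma_1\sigma_2\sigma_1)^2\in B_3$. The restriction $\overline{\rho}|_{\mathrm{Bu}}:\mathrm{Bu}\to\mathrm{PSL}(2,\mathbb{Z})$ is surjective and its kernel is the center $Z(\mathrm{Bu})$, which is infinite cyclic generated by $\beta(\Delta)$. In other words, $\overline{\rho}$ induces a short exact sequence $1\to\mathbb{Z}\to\mathrm{Bu}\to\mathrm{PSL}(2,\mathbb{Z})\to1$.
   Context: Let $B_3$ be the braid group on three strands with standard generators $\sigma_1,\sigma_2$, and $\beta:B_3\to\mathrm{GL}(3,\mathbb{Z}[t,t^{-1}])$ the Burau representation $\beta(\sigma_1)=\begin{pmatrix}1-t&t&0\\1&0&0\\0&0&1\end{pmatrix}$, $\beta(\sigma_2)=\begin{pmatrix}1&0&0\\0&1-t&t\\0&1&0\end{pmatrix}$. For $A\in\mathrm{Bu}$, let $B=A|_{t=-1}\in\mathrm{GL}(3,\mathbb{Z})$ and $\rho(B)=\begin{pmatrix}1-B_{13}&1-B_{11}\\1-B_{33}&1-B_{31}\end{pmatrix}\in\mathrm{GL}(2,\mathbb{Z})$; $\overline{\rho}(A)$ is the image of $\rho(B)$ in the projective linear group $\mathrm{PGL}(2,\mathbb{Q}(t))$ (quotient by nonzero scalars). $\mathrm{PSL}(2,\mathbb{Z})$ is identified with the image of $\mathrm{SL}(2,\mathbb{Z})$ there. *)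

theory Defs
  imports "HOL-Analysis.Analysis" "HOL-Computational_Algebra.Formal_Laurent_Series"
    "HOL-Computational_Algebra.Fraction_Field" "HOL-Computational_Algebra.Polynomial"
begin

text \<open>Laurent polynomials Z[t,t^-1] are represented inside the ring of integer formal
Laurent series; t is fls_X and t^-1 is fls_X_inv.  3x3 matrices are int fls ^3^3, indexed
1,2,3 (row index first).\<close>

type_synonym lpoly = "int fls"

definition tL :: lpoly where "tL = fls_X"
definition tLinv :: lpoly where "tLinv = fls_X_inv"

definition mat3 :: "'a::zero \<Rightarrow> 'a \<Rightarrow> 'a \<Rightarrow> 'a \<Rightarrow> 'a \<Rightarrow> 'a \<Rightarrow> 'a \<Rightarrow> 'a \<Rightarrow> 'a \<Rightarrow> 'a^3^3" where
  "mat3 a b c d e f g h i = vector [vector [a,b,c], vector [d,e,f], vector [g,h,i]]"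

definition mat2 :: "'a::zero \<Rightarrow> 'a \<Rightarrow> 'a \<Rightarrow> 'a \<Rightarrow> 'a^2^2" where
  "mat2 a b c d = vector [vector [a,b], vector [c,d]]"

text \<open>Burau images of the generators and of their inverses.\<close>
definition bs1 :: "lpoly^3^3" where "bs1 = mat3 (1 - tL) tL 0  1 0 0  0 0 1"
definition bs2 :: "lpoly^3^3" where "bs2 = mat3 1 0 0  0 (1 - tL) tL  0 1 0"
definition bs1inv :: "lpoly^3^3" where "bs1inv = mat3 0 1 0  tLinv (1 - tLinv) 0  0 0 1"
definition bs2inv :: "lpoly^3^3" where "bs2inv = mat3 1 0 0  0 0 1  0 tLinv (1 - tLinv)"

text \<open>Bu = beta(B_3): the subgroup generated by the images of the generators, i.e. the set of
all products of words in the generators and their inverses.\<close>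
inductive_set Bu :: "(lpoly^3^3) set" where
  Bu_one: "mat 1 \<in> Bu"
| Bu_mult: "A \<in> Bu \<Longrightarrow> g \<in> {bs1, bs2, bs1inv, bs2inv} \<Longrightarrow> g ** A \<in> Bu"

definition center_Bu :: "(lpoly^3^3) set" where
  "center_Bu = {A \<in> Bu. \<forall>B \<in> Bu. A ** B = B ** A}"

text \<open>beta(Delta), Delta = (s1 s2 s1)^2, and beta(Delta^-1).\<close>
definition bDelta :: "lpoly^3^3" where
  "bDelta = bs1 ** bs2 ** bs1 ** bs1 ** bs2 ** bs1"
definition bDelta_inv :: "lpoly^3^3" where
  "bDelta_inv = bs1inv ** bs2inv ** bs1inv ** bs1inv ** bs2inv ** bs1inv"

text \<open>Integer powers beta(Delta)^k.\<close>
definition bDelta_pow :: "int \<Rightarrow> lpoly^3^3" where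
  "bDelta_pow k = (if 0 \<le> k then (((**) bDelta) ^^ nat k) (mat 1)
                   else (((**) bDelta_inv) ^^ nat (- k)) (mat 1))"

text \<open>Evaluation of a Laurent polynomial at t = -1.\<close>
definition eval_m1 :: "lpoly \<Rightarrow> int" where
  "eval_m1 f = (\<Sum>n \<in> {n. fls_nth f n \<noteq> 0}. (if even n then 1 else -1) * fls_nth f n)"

definition spec_m1 :: "lpoly^3^3 \<Rightarrow> int^3^3" where
  "spec_m1 A = (\<chi> i j. eval_m1 (A $ i $ j))"

text \<open>rho(B) = ((1-B13, 1-B11), (1-B33, 1-B31)).\<close>
definition rho :: "int^3^3 \<Rightarrow> int^2^2" where
  "rho B = mat2 (1 - B$1$3) (1 - B$1$1) (1 - B$3$3) (1 - B$3$1)"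

text \<open>Equality of the images in PGL(2, Q(t)): equal up to a nonzero scalar of Q(t).\<close>
definition proj_eq :: "int^2^2 \<Rightarrow> int^2^2 \<Rightarrow> bool" where
  "proj_eq M N \<longleftrightarrow> (\<exists>c :: rat poly fract. c \<noteq> 0 \<and>
      (\<forall>i j. (of_int (M $ i $ j) :: rat poly fract) = c * of_int (N $ i $ j)))"

definition rhobar_in_PSL :: "int^2^2 \<Rightarrow> bool" where
  "rhobar_in_PSL M \<longleftrightarrow> (\<exists>N :: int^2^2. det N = 1 \<and> proj_eq M N)"

end

theory Submission
  imports Defs
begin

text \<open>At t = -1 every Burau matrix has row sums 1 and is fixed on the left by (1, -1, 1); on
integer matrices with these two fixed vectors rho is multiplicative. So rho after evaluation at -1
is a homomorphism from Bu to SL(2, Z), sending sigma1 and sigma2 to [[1,-1],[0,1]] and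
[[1,0],[1,1]], and it is onto by the Euclidean algorithm. With U = sigma1 sigma2 sigma1 and
V = sigma1 sigma2 we have U^2 = V^3 = Delta, which is central, so every element of Bu is a power of
Delta times a word alternating between U and V^(+-1). A ping-pong argument with nonnegative
matrices shows that no nonempty such word is sent to +-1, hence the kernel of the projectivised map
consists of the powers of Delta. A central element commutes with the images of sigma1 and sigma2 and
therefore lies in this kernel. Finally det beta(Delta) = t^6, so the powers of Delta are distinct.\<close>

no_notation fps_nth (infixl \<open>$\<close> 75)

section \<open>Explicit 2x2 and 3x3 matrices\<close>

lemma mat3_nth [simp]:
  "mat3 a b c d e f g h i $ 1 $ 1 = a" "mat3 a b c d e f g h i $ 1 $ 2 = b"
  "mat3 a b c d e f g h i $ 1 $ 3 = c" "mat3 a b c d e f g h i $ 2 $ 1 = d"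
  "mat3 a b c d e f g h i $ 2 $ 2 = e" "mat3 a b c d e f g h i $ 2 $ 3 = f"
  "mat3 a b c d e f g h i $ 3 $ 1 = g" "mat3 a b c d e f g h i $ 3 $ 2 = h"
  "mat3 a b c d e f g h i $ 3 $ 3 = i"
  by (simp_all add: mat3_def)

lemma mat3_eq_iff:
  "mat3 a b c d e f g h i = mat3 a' b' c' d' e' f' g' h' i' \<longleftrightarrow>
   a = a' \<and> b = b' \<and> c = c' \<and> d = d' \<and> e = e' \<and> f = f' \<and> g = g' \<and> h = h' \<and> i = i'"
  by (auto simp: vec_eq_iff forall_3)

lemma mat3_mult:
  "mat3 a b c d e f g h i ** mat3 a' b' c' d' e' f' g' h' i' =
   mat3 (a*a' + b*d' + c*g') (a*b' + b*e' + c*h') (a*c' + b*f' + c*i')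
        (d*a' + e*d' + f*g') (d*b' + e*e' + f*h') (d*c' + e*f' + f*i')
        (g*a' + h*d' + i*g') (g*b' + h*e' + i*h') (g*c' + h*f' + i*i')"
  by (simp add: vec_eq_iff forall_3 matrix_matrix_mult_def sum_3)

lemma mat3_cases: obtains a b c d e f g h i where "(M :: 'a::zero^3^3) = mat3 a b c d e f g h i"
proof
  show "M = mat3 (M$1$1) (M$1$2) (M$1$3) (M$2$1) (M$2$2) (M$2$3) (M$3$1) (M$3$2) (M$3$3)"
    by (simp add: vec_eq_iff forall_3)
qed

lemma mat3_one: "(mat 1 :: 'a::{zero,one}^3^3) = mat3 1 0 0 0 1 0 0 0 1"
  by (simp add: vec_eq_iff forall_3 mat_def)

lemma mat2_nth [simp]:
  "mat2 a b c d $ 1 $ 1 = a" "mat2 a b c d $ 1 $ 2 = b"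
  "mat2 a b c d $ 2 $ 1 = c" "mat2 a b c d $ 2 $ 2 = d"
  by (simp_all add: mat2_def)

lemma mat2_cases: obtains a b c d where "(M :: 'a::zero^2^2) = mat2 a b c d"
proof
  show "M = mat2 (M$1$1) (M$1$2) (M$2$1) (M$2$2)"
    by (simp add: vec_eq_iff forall_2)
qed

lemma mat2_eq_iff: "mat2 a b c d = mat2 a' b' c' d' \<longleftrightarrow> a = a' \<and> b = b' \<and> c = c' \<and> d = d'"
  by (auto simp: vec_eq_iff forall_2)

lemma mat2_mult:
  "mat2 a b c d ** mat2 a' b' c' d' = mat2 (a*a' + b*c') (a*b' + b*d') (c*a' + d*c') (c*b' + d*d')"
  by (simp add: vec_eq_iff forall_2 matrix_matrix_mult_def sum_2)

lemma mat2_one: "(mat 1 :: 'a::{zero,one}^2^2) = mat2 1 0 0 1"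
  by (simp add: vec_eq_iff forall_2 mat_def)

lemma mat2_uminus: "- mat2 a b c d = mat2 (- a) (- b) (- c) (- d :: 'a::ab_group_add)"
  by (simp add: vec_eq_iff forall_2)

lemma det_mat2: "det (mat2 a b c d :: 'a::comm_ring_1^2^2) = a * d - b * c"
  by (simp add: det_2)

section \<open>Laurent polynomials and evaluation at t = -1\<close>

text \<open>Since eval_m1 sums over the support, it is only meaningful (and a ring homomorphism) on
finitely supported series, i.e. on genuine Laurent polynomials.\<close>

definition is_lpoly :: "lpoly \<Rightarrow> bool" where
  "is_lpoly f \<longleftrightarrow> finite {n. fls_nth f n \<noteq> 0}"

lemma eval_m1_eq_sum:
  assumes "finite S" "{n. fls_nth f n \<noteq> 0} \<subseteq> S"
  shows "eval_m1 f = (\<Sum>n\<in>S. (if even n then 1 else -1) * fls_nth f n)"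
  unfolding eval_m1_def by (rule sum.mono_neutral_left) (use assms in auto)

lemma is_lpoly_add: "is_lpoly f \<Longrightarrow> is_lpoly g \<Longrightarrow> is_lpoly (f + g)"
  and is_lpoly_diff: "is_lpoly f \<Longrightarrow> is_lpoly g \<Longrightarrow> is_lpoly (f - g)"
  unfolding is_lpoly_def
  by (auto intro: rev_finite_subset[of "{n. fls_nth f n \<noteq> 0} \<union> {n. fls_nth g n \<noteq> 0}"])

lemma is_lpoly_0: "is_lpoly 0"
  unfolding is_lpoly_def by simp

lemma is_lpoly_1: "is_lpoly 1"
  unfolding is_lpoly_def by (rule finite_subset[of _ "{0}"]) auto

lemma is_lpoly_const_mult: "is_lpoly f \<Longrightarrow> is_lpoly (fls_const c * f)"
  unfolding is_lpoly_def by (rule rev_finite_subset) auto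

lemma eval_m1_0: "eval_m1 0 = 0"
  by (simp add: eval_m1_def)

lemma eval_m1_1: "eval_m1 1 = 1"
  by (subst eval_m1_eq_sum[of "{0}"]) auto

lemma eval_m1_add:
  assumes "is_lpoly f" "is_lpoly g"
  shows "eval_m1 (f + g) = eval_m1 f + eval_m1 g"
proof -
  let ?S = "{n. fls_nth f n \<noteq> 0} \<union> {n. fls_nth g n \<noteq> 0}"
  have "finite ?S"
    using assms unfolding is_lpoly_def by simp
  then show ?thesis
    by (subst (1 2 3) eval_m1_eq_sum[of ?S]) (auto simp: sum.distrib algebra_simps)
qed

lemma eval_m1_diff: "is_lpoly f \<Longrightarrow> is_lpoly g \<Longrightarrow> eval_m1 (f - g) = eval_m1 f - eval_m1 g"
  using eval_m1_add[of "f - g" g] by (simp add: is_lpoly_diff)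

lemma eval_m1_const_mult: "eval_m1 (fls_const c * f) = c * eval_m1 f"
proof (cases "c = 0")
  case False
  then show ?thesis
    by (simp add: eval_m1_def sum_distrib_left algebra_simps)
qed (simp add: eval_m1_def)

lemma is_lpoly_shift: "is_lpoly f \<Longrightarrow> is_lpoly (fls_shift m f)"
  unfolding is_lpoly_def
  by (rule finite_surj[of _ _ "\<lambda>k. k - m"]) (auto intro!: image_eqI[of _ _ "_ + m"])

lemma eval_m1_shift:
  assumes "is_lpoly f"
  shows "eval_m1 (fls_shift m f) = (if even m then 1 else -1) * eval_m1 f"
proof -
  let ?S = "{n. fls_nth f n \<noteq> 0}"
  have "eval_m1 (fls_shift m f) =
      (\<Sum>k\<in>(\<lambda>k. k - m) ` ?S. (if even k then 1 else -1) * fls_nth (fls_shift m f) k)"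
    by (rule eval_m1_eq_sum) (use assms in \<open>auto simp: is_lpoly_def intro!: image_eqI[of _ _ "_ + m"]\<close>)
  also have "\<dots> = (if even m then 1 else -1) * (\<Sum>k\<in>?S. (if even k then 1 else -1) * fls_nth f k)"
    by (subst sum.reindex) (auto simp: inj_on_def sum_distrib_left sum_negf[symmetric] intro!: sum.cong)
  also have "\<dots> = (if even m then 1 else -1) * eval_m1 f"
    unfolding eval_m1_def ..
  finally show ?thesis .
qed

lemma is_lpoly_X_intpow: "is_lpoly (fls_X_intpow n)"
  using is_lpoly_shift[OF is_lpoly_1] by simp

lemma eval_m1_X_intpow: "eval_m1 (fls_X_intpow n) = (if even n then 1 else -1)"
  using eval_m1_shift[OF is_lpoly_1, of "- n"] by (simp add: eval_m1_1)

lemma lpoly_induct [consumes 1, case_names zero monom]: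
  assumes "is_lpoly f"
    and "P 0"
    and "\<And>f c n. is_lpoly f \<Longrightarrow> P f \<Longrightarrow> P (fls_const c * fls_X_intpow n + f)"
  shows "P f"
proof -
  have "\<forall>f. {n. fls_nth f n \<noteq> 0} \<subseteq> S \<longrightarrow> P f" if "finite S" for S
    using that
  proof (induction S rule: finite_induct)
    case empty
    have "f = 0" if "{n. fls_nth f n \<noteq> 0} \<subseteq> {}" for f :: lpoly
      using that by (intro fls_eqI) auto
    then show ?case
      using assms(2) by blast
  next
    case (insert n S)
    show ?case
    proof (intro allI impI)
      fix f :: lpoly
      assume supp: "{k. fls_nth f k \<noteq> 0} \<subseteq> insert n S"
      define m where "m = fls_const (fls_nth f n) * fls_X_intpow n"
      have "{k. fls_nth (f - m) k \<noteq> 0} \<subseteq> S"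
        using supp by (auto simp: m_def fls_X_intpow_times_conv_shift)
      then have "is_lpoly (f - m)" "P (f - m)"
        using insert by (auto simp: is_lpoly_def intro: finite_subset)
      then show "P f"
        using assms(3)[of "f - m" "fls_nth f n" n] unfolding m_def by simp
    qed
  qed
  then show ?thesis
    using assms(1) unfolding is_lpoly_def by blast
qed

lemma is_lpoly_mult: "is_lpoly f \<Longrightarrow> is_lpoly g \<Longrightarrow> is_lpoly (f * g)"
  and eval_m1_mult: "is_lpoly f \<Longrightarrow> is_lpoly g \<Longrightarrow> eval_m1 (f * g) = eval_m1 f * eval_m1 g"
proof -
  assume f: "is_lpoly f" and g: "is_lpoly g"
  have "is_lpoly (f * g) \<and> eval_m1 (f * g) = eval_m1 f * eval_m1 g"
    using f
  proof (induction f rule: lpoly_induct)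
    case zero
    then show ?case by (simp add: is_lpoly_0 eval_m1_0)
  next
    case (monom f c n)
    let ?s = "if even n then 1 else -1 :: int"
    have prod: "(fls_const c * fls_X_intpow n + f) * g = fls_const c * fls_shift (- n) g + f * g"
      by (simp only: distrib_right mult.assoc fls_X_intpow_times_conv_shift(1))
    have "is_lpoly ((fls_const c * fls_X_intpow n + f) * g)"
      unfolding prod using monom g by (simp add: is_lpoly_add is_lpoly_const_mult is_lpoly_shift)
    moreover have "eval_m1 ((fls_const c * fls_X_intpow n + f) * g) = c * ?s * eval_m1 g + eval_m1 f * eval_m1 g"
      unfolding prod using monom g
      by (simp add: eval_m1_add is_lpoly_const_mult is_lpoly_shift eval_m1_const_mult eval_m1_shift)
    moreover have "eval_m1 (fls_const c * fls_X_intpow n + f) = c * ?s + eval_m1 f"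
      using monom by (simp add: eval_m1_add is_lpoly_const_mult is_lpoly_X_intpow eval_m1_const_mult
          eval_m1_X_intpow)
    ultimately show ?case
      by (simp add: algebra_simps)
  qed
  then show "is_lpoly (f * g)" "eval_m1 (f * g) = eval_m1 f * eval_m1 g"
    by auto
qed

lemma is_lpoly_sum: "(\<And>x. x \<in> S \<Longrightarrow> is_lpoly (f x)) \<Longrightarrow> is_lpoly (\<Sum>x\<in>S. f x)"
  and eval_m1_sum: "(\<And>x. x \<in> S \<Longrightarrow> is_lpoly (f x)) \<Longrightarrow>
    eval_m1 (\<Sum>x\<in>S. f x) = (\<Sum>x\<in>S. eval_m1 (f x))"
proof -
  assume "\<And>x. x \<in> S \<Longrightarrow> is_lpoly (f x)"
  then have "is_lpoly (\<Sum>x\<in>S. f x) \<and> eval_m1 (\<Sum>x\<in>S. f x) = (\<Sum>x\<in>S. eval_m1 (f x))"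
    by (induction S rule: infinite_finite_induct)
      (simp_all add: is_lpoly_0 eval_m1_0 is_lpoly_add eval_m1_add)
  then show "is_lpoly (\<Sum>x\<in>S. f x)" "eval_m1 (\<Sum>x\<in>S. f x) = (\<Sum>x\<in>S. eval_m1 (f x))"
    by auto
qed

definition lpoly_mat :: "lpoly^'n^'m \<Rightarrow> bool" where
  "lpoly_mat A \<longleftrightarrow> (\<forall>i j. is_lpoly (A $ i $ j))"

lemma lpoly_mat_mult: "lpoly_mat A \<Longrightarrow> lpoly_mat B \<Longrightarrow> lpoly_mat (A ** B)"
  unfolding lpoly_mat_def matrix_matrix_mult_def by (simp add: is_lpoly_sum is_lpoly_mult)

lemma spec_m1_mult: "lpoly_mat A \<Longrightarrow> lpoly_mat B \<Longrightarrow> spec_m1 (A ** B) = spec_m1 A ** spec_m1 B"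
  unfolding lpoly_mat_def spec_m1_def matrix_matrix_mult_def
  by (simp add: vec_eq_iff eval_m1_sum eval_m1_mult is_lpoly_mult)

lemma spec_m1_one: "spec_m1 (mat 1) = mat 1"
  by (simp add: spec_m1_def mat_def vec_eq_iff eval_m1_0 eval_m1_1)

section \<open>Braid relations in Bu and the powers of Delta\<close>

lemma tL_tLinv: "tL * tLinv = 1" "tLinv * tL = 1"
  by (simp_all add: tL_def tLinv_def fls_X_times_conv_shift)

lemma bs_inverse:
  "bs1 ** bs1inv = mat 1" "bs1inv ** bs1 = mat 1" "bs2 ** bs2inv = mat 1" "bs2inv ** bs2 = mat 1"
  by (simp_all add: bs1_def bs1inv_def bs2_def bs2inv_def mat3_mult mat3_one tL_tLinv algebra_simps)

lemma bs_inverse_cancel: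
  "bs1 ** (bs1inv ** X) = X" "bs1inv ** (bs1 ** X) = X" "bs2 ** (bs2inv ** X) = X" "bs2inv ** (bs2 ** X) = X"
  by (simp_all add: matrix_mul_assoc bs_inverse)

lemma braid_relation: "bs1 ** bs2 ** bs1 = bs2 ** bs1 ** bs2"
  by (simp add: bs1_def bs2_def mat3_mult algebra_simps)

abbreviation Bu_gens :: "(lpoly^3^3) set" where
  "Bu_gens \<equiv> {bs1, bs2, bs1inv, bs2inv}"

lemma Bu_gen: "g \<in> Bu_gens \<Longrightarrow> g \<in> Bu"
  using Bu_mult[OF Bu_one] by auto

lemma Bu_mult_closed: "A \<in> Bu \<Longrightarrow> B \<in> Bu \<Longrightarrow> A ** B \<in> Bu"
  by (induction A rule: Bu.induct) (simp_all add: Bu.Bu_mult flip: matrix_mul_assoc)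

lemma Bu_commute:
  assumes "\<And>g. g \<in> Bu_gens \<Longrightarrow> g ** C = C ** g" and "A \<in> Bu"
  shows "A ** C = C ** A"
  using assms(2)
proof (induction A rule: Bu.induct)
  case (Bu_mult A g)
  then show ?case
    using assms(1)[of g] by (metis matrix_mul_assoc)
qed simp

lemma commute_inverse:
  assumes "g ** h = mat 1" "h ** g = mat 1" "g ** C = C ** g"
  shows "h ** C = C ** h"
  by (metis assms matrix_mul_assoc matrix_mul_lid matrix_mul_rid)

definition bHalf :: "lpoly^3^3" where
  "bHalf = bs1 ** bs2 ** bs1"

lemma bDelta_eq_bHalf_squared: "bDelta = bHalf ** bHalf"
  by (simp add: bDelta_def bHalf_def matrix_mul_assoc)

lemma bs_conj_bHalf: "bs1 ** bHalf = bHalf ** bs2" "bs2 ** bHalf = bHalf ** bs1"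
  by (metis bHalf_def braid_relation matrix_mul_assoc)+

lemma bDelta_commute: "A \<in> Bu \<Longrightarrow> A ** bDelta = bDelta ** A"
proof (rule Bu_commute)
  have "bs1 ** bDelta = bDelta ** bs1" "bs2 ** bDelta = bDelta ** bs2"
    unfolding bDelta_eq_bHalf_squared by (metis bs_conj_bHalf matrix_mul_assoc)+
  then show "g ** bDelta = bDelta ** g" if "g \<in> Bu_gens" for g
    using that commute_inverse bs_inverse by blast
qed

lemma bDelta_inverse: "bDelta_inv ** bDelta = mat 1" "bDelta ** bDelta_inv = mat 1"
  unfolding bDelta_def bDelta_inv_def by (simp_all add: bs_inverse bs_inverse_cancel flip: matrix_mul_assoc)

lemma bDelta_inverse_cancel: "bDelta_inv ** (bDelta ** X) = X" "bDelta ** (bDelta_inv ** X) = X"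
  by (simp_all add: matrix_mul_assoc bDelta_inverse)

lemma bDelta_inv_commute: "A \<in> Bu \<Longrightarrow> A ** bDelta_inv = bDelta_inv ** A"
  using commute_inverse[OF bDelta_inverse(2,1)] bDelta_commute by metis

lemma bDelta_in_Bu: "bDelta \<in> Bu" "bDelta_inv \<in> Bu"
  unfolding bDelta_def bDelta_inv_def by (simp_all add: Bu_mult_closed Bu_gen)

lemma bDelta_pow_0: "bDelta_pow 0 = mat 1"
  by (simp add: bDelta_pow_def)

lemma bDelta_pow_of_nat: "bDelta_pow (int n) = ((**) bDelta ^^ n) (mat 1)"
  by (simp add: bDelta_pow_def)

lemma bDelta_pow_minus_of_nat: "bDelta_pow (- int n) = ((**) bDelta_inv ^^ n) (mat 1)"
proof (cases "n = 0")
  case False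
  then have "\<not> 0 \<le> - int n" "nat (- (- int n)) = n"
    by simp_all
  then show ?thesis
    unfolding bDelta_pow_def by (simp only: if_False)
qed (simp add: bDelta_pow_def)

lemma bDelta_pow_succ: "bDelta_pow (k + 1) = bDelta ** bDelta_pow k"
proof (cases "k \<ge> 0")
  case True
  then obtain n where "k = int n"
    by (metis nonneg_eq_int)
  moreover have "int n + 1 = int (Suc n)"
    by simp
  ultimately show ?thesis
    by (simp only: bDelta_pow_of_nat funpow.simps o_apply)
next
  case False
  then obtain n where n: "k = - int (Suc n)"
    by (metis neg_int_cases gr0_implies_Suc not_le)
  have succ: "- int (Suc n) + 1 = - int n"
    by simp
  show ?thesis
    unfolding n succ bDelta_pow_minus_of_nat by (simp add: bDelta_inverse_cancel)
qed

lemma bDelta_pow_pred: "bDelta_pow (k - 1) = bDelta_inv ** bDelta_pow k"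
  using bDelta_pow_succ[of "k - 1"] by (simp add: bDelta_inverse_cancel)

lemma bDelta_pow_1: "bDelta_pow 1 = bDelta" "bDelta_pow (-1) = bDelta_inv"
  using bDelta_pow_succ[of 0] bDelta_pow_pred[of 0] by (simp_all add: bDelta_pow_0)

lemma bDelta_pow_add: "bDelta_pow (j + k) = bDelta_pow j ** bDelta_pow k"
proof (induction j rule: int_induct[where k = 0])
  case base
  then show ?case by (simp add: bDelta_pow_0)
next
  case (step1 i)
  have "bDelta_pow (i + 1 + k) = bDelta_pow ((i + k) + 1)"
    by (simp add: ac_simps)
  with step1 show ?case
    by (simp add: bDelta_pow_succ matrix_mul_assoc)
next
  case (step2 i)
  have "bDelta_pow (i - 1 + k) = bDelta_pow ((i + k) - 1)"
    by (simp add: algebra_simps)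
  with step2 show ?case
    by (simp add: bDelta_pow_pred matrix_mul_assoc)
qed

lemma bDelta_pow_in_Bu: "bDelta_pow k \<in> Bu"
  by (induction k rule: int_induct[where k = 0])
    (simp_all add: bDelta_pow_0 Bu_one bDelta_pow_succ bDelta_pow_pred Bu_mult_closed bDelta_in_Bu)

lemma bDelta_pow_commute:
  assumes "A \<in> Bu"
  shows "A ** bDelta_pow k = bDelta_pow k ** A"
proof (induction k rule: int_induct[where k = 0])
  case base
  then show ?case by (simp add: bDelta_pow_0)
next
  case (step1 i)
  then show ?case
    using bDelta_commute[OF assms] by (metis bDelta_pow_succ matrix_mul_assoc)
next
  case (step2 i)
  then show ?case
    using bDelta_inv_commute[OF assms] by (metis bDelta_pow_pred matrix_mul_assoc)
qed

lemma bDelta_pow_in_center: "bDelta_pow k \<in> center_Bu"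
  unfolding center_Bu_def using bDelta_pow_in_Bu bDelta_pow_commute by auto

section \<open>A normal form for Bu\<close>

datatype letter = U | V | Vinv

fun letter_mat :: "letter \<Rightarrow> lpoly^3^3" where
  "letter_mat U = bHalf"
| "letter_mat V = bs1 ** bs2"
| "letter_mat Vinv = bs2inv ** bs1inv"

fun word_mat :: "letter list \<Rightarrow> lpoly^3^3" where
  "word_mat [] = mat 1"
| "word_mat (l # w) = letter_mat l ** word_mat w"

fun alternating :: "letter list \<Rightarrow> bool" where
  "alternating (x # y # w) \<longleftrightarrow> (x = U \<longleftrightarrow> y \<noteq> U) \<and> alternating (y # w)"
| "alternating _ \<longleftrightarrow> True"

lemma alternating_ConsD: "alternating (x # w) \<Longrightarrow> alternating w"
  by (cases w) auto

lemma alternating_Cons_hd: "alternating (x # w) \<Longrightarrow> x \<noteq> U \<Longrightarrow> w = [] \<or> hd w = U"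
  by (cases w) auto

lemma alternating_Cons_cong: "(x = U \<longleftrightarrow> y = U) \<Longrightarrow> alternating (x # w) = alternating (y # w)"
  by (cases w) auto

lemma word_mat_append: "word_mat (v @ w) = word_mat v ** word_mat w"
  by (induction v) (simp_all add: matrix_mul_assoc)

lemma letter_mat_in_Bu: "letter_mat l \<in> Bu"
  by (cases l) (simp_all add: bHalf_def Bu_mult_closed Bu_gen)

lemma word_mat_in_Bu: "word_mat w \<in> Bu"
  by (induction w) (simp_all add: Bu_one Bu_mult_closed letter_mat_in_Bu)

lemma bDelta_eq_word_mat: "bDelta = word_mat [U, U]" "bDelta = word_mat [V, V, V]"
proof -
  show "bDelta = word_mat [U, U]"
    by (simp add: bDelta_eq_bHalf_squared)
  have "bDelta = (bs1 ** bs2 ** bs1) ** (bs2 ** bs1 ** bs2)"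
    unfolding bDelta_eq_bHalf_squared bHalf_def by (subst (2) braid_relation) (rule refl)
  then show "bDelta = word_mat [V, V, V]"
    by (simp add: matrix_mul_assoc)
qed

lemma word_mat_V_Vinv: "word_mat [V, Vinv] = mat 1" "word_mat [Vinv, V] = mat 1"
  by (simp_all add: bs_inverse_cancel bs_inverse flip: matrix_mul_assoc)

lemma word_mat_pair_reduce:
  assumes "l = U \<longleftrightarrow> m = U"
  obtains j ws where "word_mat [l, m] = bDelta_pow j ** word_mat ws"
    and "ws = [] \<or> (\<exists>m'. ws = [m'] \<and> m' \<noteq> U \<and> m \<noteq> U)"
proof -
  have VV: "word_mat [V, V] = bDelta ** word_mat [Vinv]"
    and "bDelta ** word_mat [Vinv, Vinv] = word_mat [V]"
    unfolding bDelta_eq_word_mat(2) by (simp_all add: bs_inverse bs_inverse_cancel flip: matrix_mul_assoc)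
  then have ViVi: "word_mat [Vinv, Vinv] = bDelta_inv ** word_mat [V]"
    by (metis bDelta_inverse_cancel(1))
  from assms consider "l = U" "m = U" | "l = V" "m = V" | "l = Vinv" "m = Vinv"
    | "l = V" "m = Vinv" | "l = Vinv" "m = V"
    by (cases l; cases m) auto
  then show thesis
  proof cases
    case 1
    then show thesis
      by (intro that[of 1 "[]"]) (simp_all add: bDelta_pow_1 bDelta_eq_word_mat(1))
  next
    case 2
    then show thesis
      using VV by (intro that[of 1 "[Vinv]"]) (simp_all add: bDelta_pow_1)
  next
    case 3
    then show thesis
      using ViVi by (intro that[of "-1" "[V]"]) (simp_all add: bDelta_pow_1)
  qed (use that[of 0 "[]"] word_mat_V_Vinv in \<open>simp_all add: bDelta_pow_0\<close>)
qed

definition delta_normal_form :: "lpoly^3^3 \<Rightarrow> bool" where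
  "delta_normal_form A \<longleftrightarrow> (\<exists>j w. alternating w \<and> A = bDelta_pow j ** word_mat w)"

lemma delta_normal_formI: "alternating w \<Longrightarrow> A = bDelta_pow j ** word_mat w \<Longrightarrow> delta_normal_form A"
  unfolding delta_normal_form_def by blast

lemma delta_normal_form_letter_word:
  assumes "alternating w"
  shows "delta_normal_form (letter_mat l ** word_mat w)"
proof (cases w)
  case Nil
  then show ?thesis
    by (intro delta_normal_formI[of "[l]" _ 0]) (simp_all add: bDelta_pow_0)
next
  case (Cons m w')
  show ?thesis
  proof (cases "l = U \<longleftrightarrow> m = U")
    case False
    with assms have "alternating (l # w)"
      unfolding Cons by simp
    then show ?thesis
      by (rule delta_normal_formI[where j = 0]) (simp add: bDelta_pow_0)
  next
    case True
    then obtain j ws where pair: "word_mat [l, m] = bDelta_pow j ** word_mat ws"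
      and ws: "ws = [] \<or> (\<exists>m'. ws = [m'] \<and> m' \<noteq> U \<and> m \<noteq> U)"
      by (rule word_mat_pair_reduce)
    have "letter_mat l ** word_mat w = word_mat [l, m] ** word_mat w'"
      by (simp add: Cons matrix_mul_assoc)
    also have "\<dots> = bDelta_pow j ** word_mat (ws @ w')"
      by (simp only: pair word_mat_append matrix_mul_assoc)
    finally have "letter_mat l ** word_mat w = bDelta_pow j ** word_mat (ws @ w')" .
    moreover have "alternating (ws @ w')"
      using ws
    proof
      assume "ws = []"
      then show ?thesis
        using assms alternating_ConsD[of m w'] unfolding Cons by simp
    next
      assume "\<exists>m'. ws = [m'] \<and> m' \<noteq> U \<and> m \<noteq> U"
      then obtain m' where "ws = [m']" "m' = U \<longleftrightarrow> m = U"
        by blast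
      then show ?thesis
        using assms alternating_Cons_cong[of m' m w'] unfolding Cons by simp
    qed
    ultimately show ?thesis
      by (rule delta_normal_formI[rotated])
  qed
qed

lemma delta_normal_form_bDelta_pow_mult:
  "delta_normal_form A \<Longrightarrow> delta_normal_form (bDelta_pow k ** A)"
  unfolding delta_normal_form_def by (metis bDelta_pow_add matrix_mul_assoc)

lemma delta_normal_form_letter_mult:
  assumes "delta_normal_form A"
  shows "delta_normal_form (letter_mat l ** A)"
proof -
  obtain j w where "alternating w" "A = bDelta_pow j ** word_mat w"
    using assms unfolding delta_normal_form_def by blast
  then have "letter_mat l ** A = bDelta_pow j ** (letter_mat l ** word_mat w)"
    by (metis bDelta_pow_commute letter_mat_in_Bu matrix_mul_assoc)
  then show ?thesis
    using \<open>alternating w\<close> by (simp add: delta_normal_form_letter_word delta_normal_form_bDelta_pow_mult)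
qed

lemma delta_normal_form_word_mult: "delta_normal_form A \<Longrightarrow> delta_normal_form (word_mat w ** A)"
  by (induction w) (simp_all add: delta_normal_form_letter_mult flip: matrix_mul_assoc)

lemma Bu_gens_as_words:
  "bs1 = word_mat [Vinv, U]" "bs2 = word_mat [U, Vinv]"
  "bs1inv = bDelta_pow (-1) ** word_mat [U, V]" "bs2inv = bDelta_pow (-1) ** word_mat [V, U]"
proof -
  have bHalf_alt: "bHalf = bs2 ** bs1 ** bs2"
    unfolding bHalf_def by (rule braid_relation)
  show "bs1 = word_mat [Vinv, U]"
    by (simp add: bHalf_def bs_inverse_cancel flip: matrix_mul_assoc)
  show "bs2 = word_mat [U, Vinv]"
    by (simp add: bHalf_alt bs_inverse bs_inverse_cancel flip: matrix_mul_assoc)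
  have bDelta_alt: "bDelta = bHalf ** (bs2 ** bs1 ** bs2)"
    by (simp add: bDelta_eq_bHalf_squared flip: bHalf_alt)
  have "bDelta ** bs1inv = word_mat [U, V]"
    by (simp add: bDelta_eq_bHalf_squared bHalf_def bs_inverse flip: matrix_mul_assoc)
  moreover have "bDelta ** bs2inv = word_mat [V, U]"
    unfolding bDelta_alt by (simp add: bHalf_def bs_inverse flip: matrix_mul_assoc)
  ultimately show "bs1inv = bDelta_pow (-1) ** word_mat [U, V]" "bs2inv = bDelta_pow (-1) ** word_mat [V, U]"
    by (metis bDelta_pow_1(2) bDelta_inverse_cancel(1))+
qed

lemma Bu_delta_normal_form: "A \<in> Bu \<Longrightarrow> delta_normal_form A"
proof (induction A rule: Bu.induct)
  case Bu_one
  then show ?case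
    by (intro delta_normal_formI[of "[]" _ 0]) (simp_all add: bDelta_pow_0)
next
  case (Bu_mult A g)
  then consider "g = bs1" | "g = bs2" | "g = bs1inv" | "g = bs2inv"
    by blast
  then show ?case
  proof cases
    case 1
    then show ?thesis
      using Bu_mult.IH delta_normal_form_word_mult[of A "[Vinv, U]"] by (simp add: Bu_gens_as_words(1))
  next
    case 2
    then show ?thesis
      using Bu_mult.IH delta_normal_form_word_mult[of A "[U, Vinv]"] by (simp add: Bu_gens_as_words(2))
  next
    case 3
    then show ?thesis
      using Bu_mult.IH delta_normal_form_word_mult[of A "[U, V]"] delta_normal_form_bDelta_pow_mult
      by (simp only: Bu_gens_as_words(3) matrix_mul_assoc[symmetric])
  next
    case 4
    then show ?thesis
      using Bu_mult.IH delta_normal_form_word_mult[of A "[V, U]"] delta_normal_form_bDelta_pow_mult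
      by (simp only: Bu_gens_as_words(4) matrix_mul_assoc[symmetric])
  qed
qed

section \<open>The homomorphism from Bu to SL(2, Z)\<close>

lemma tL_eq_X_intpow: "tL = fls_X_intpow 1" "tLinv = fls_X_intpow (-1)"
  by (simp_all add: tL_def tLinv_def fls_X_conv_shift_1 fls_X_inv_conv_shift_1)

lemma is_lpoly_Burau_entries:
  "is_lpoly tL" "is_lpoly tLinv" "is_lpoly (1 - tL)" "is_lpoly (1 - tLinv)"
  using is_lpoly_X_intpow[of 1] is_lpoly_X_intpow[of "-1"]
  unfolding tL_eq_X_intpow by (simp_all add: is_lpoly_diff is_lpoly_1)

lemma eval_m1_Burau_entries:
  "eval_m1 tL = -1" "eval_m1 tLinv = -1" "eval_m1 (1 - tL) = 2" "eval_m1 (1 - tLinv) = 2"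
proof -
  show "eval_m1 tL = -1" "eval_m1 tLinv = -1"
    using eval_m1_X_intpow[of 1] eval_m1_X_intpow[of "-1"] unfolding tL_eq_X_intpow by simp_all
  then show "eval_m1 (1 - tL) = 2" "eval_m1 (1 - tLinv) = 2"
    by (simp_all add: eval_m1_diff is_lpoly_1 is_lpoly_Burau_entries eval_m1_1)
qed

lemma lpoly_mat_Bu: "A \<in> Bu \<Longrightarrow> lpoly_mat A"
proof (induction A rule: Bu.induct)
  case Bu_one
  then show ?case by (simp add: lpoly_mat_def mat_def is_lpoly_0 is_lpoly_1)
next
  case (Bu_mult A g)
  have "lpoly_mat g"
    using Bu_mult(2) unfolding lpoly_mat_def
    by (auto simp: bs1_def bs2_def bs1inv_def bs2inv_def forall_3 is_lpoly_Burau_entries is_lpoly_0 is_lpoly_1)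
  with Bu_mult show ?case
    by (simp add: lpoly_mat_mult)
qed

lemma spec_m1_Bu_mult: "A \<in> Bu \<Longrightarrow> B \<in> Bu \<Longrightarrow> spec_m1 (A ** B) = spec_m1 A ** spec_m1 B"
  by (simp add: spec_m1_mult lpoly_mat_Bu)

lemma spec_m1_gens:
  "spec_m1 bs1 = mat3 2 (-1) 0  1 0 0  0 0 1"
  "spec_m1 bs2 = mat3 1 0 0  0 2 (-1)  0 1 0"
  "spec_m1 bs1inv = mat3 0 1 0  (-1) 2 0  0 0 1"
  "spec_m1 bs2inv = mat3 1 0 0  0 0 1  0 (-1) 2"
  by (simp_all add: bs1_def bs2_def bs1inv_def bs2inv_def spec_m1_def vec_eq_iff forall_3
      eval_m1_Burau_entries eval_m1_0 eval_m1_1)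

text \<open>On the matrices with these two fixed vectors rho is multiplicative, and every Burau matrix
evaluated at t = -1 is one of them.\<close>

definition m1_invariant :: "int^3^3 \<Rightarrow> bool" where
  "m1_invariant M \<longleftrightarrow>
    M *v vector [1, 1, 1] = vector [1, 1, 1] \<and> vector [1, -1, 1] v* M = vector [1, -1, 1]"

lemma m1_invariant_mult: "m1_invariant M \<Longrightarrow> m1_invariant N \<Longrightarrow> m1_invariant (M ** N)"
  unfolding m1_invariant_def by (simp flip: matrix_vector_mul_assoc vector_matrix_mul_assoc)

lemma m1_invariant_mat3_iff:
  "m1_invariant (mat3 a b c d e f g h i) \<longleftrightarrow>
    a + b + c = 1 \<and> d + e + f = 1 \<and> g + h + i = 1 \<and> a - d + g = 1 \<and> b - e + h = -1 \<and> c - f + i = 1"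
  unfolding m1_invariant_def
  by (simp add: vec_eq_iff forall_3 matrix_vector_mult_def vector_matrix_mult_def sum_3 algebra_simps)

lemma m1_invariant_param:
  assumes "m1_invariant M"
  obtains a b c d
  where "M = mat3 a (1 - a - b) b (a + c - 1) (3 - a - b - c - d) (b + d - 1) c (1 - c - d) d"
proof -
  obtain a x b y z w c u d where M: "M = mat3 a x b y z w c u d"
    using mat3_cases by blast
  with assms have "M = mat3 a (1 - a - b) b (a + c - 1) (3 - a - b - c - d) (b + d - 1) c (1 - c - d) d"
    by (simp add: m1_invariant_mat3_iff mat3_eq_iff)
  then show thesis
    by (rule that)
qed

lemma rho_mult:
  assumes "m1_invariant M" "m1_invariant N"
  shows "rho (M ** N) = rho M ** rho N"
proof -
  obtain a b c d where M: "M = mat3 a (1 - a - b) b (a + c - 1) (3 - a - b - c - d)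
      (b + d - 1) c (1 - c - d) d"
    using assms(1) by (rule m1_invariant_param)
  obtain a' b' c' d' where N: "N = mat3 a' (1 - a' - b') b' (a' + c' - 1) (3 - a' - b' - c' - d')
      (b' + d' - 1) c' (1 - c' - d') d'"
    using assms(2) by (rule m1_invariant_param)
  show ?thesis
    unfolding M N mat3_mult rho_def mat2_mult mat2_eq_iff by (simp add: algebra_simps)
qed

lemma m1_invariant_spec_m1: "A \<in> Bu \<Longrightarrow> m1_invariant (spec_m1 A)"
proof (induction A rule: Bu.induct)
  case Bu_one
  then show ?case
    unfolding spec_m1_one by (simp add: mat3_one m1_invariant_mat3_iff)
next
  case (Bu_mult A g)
  have "m1_invariant (spec_m1 g)"
    using Bu_mult(2) by (auto simp: spec_m1_gens m1_invariant_mat3_iff)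
  with Bu_mult show ?case
    by (simp add: spec_m1_Bu_mult Bu_gen m1_invariant_mult)
qed

definition rho_m1 :: "lpoly^3^3 \<Rightarrow> int^2^2" where
  "rho_m1 A = rho (spec_m1 A)"

lemma rho_m1_mult: "A \<in> Bu \<Longrightarrow> B \<in> Bu \<Longrightarrow> rho_m1 (A ** B) = rho_m1 A ** rho_m1 B"
  by (simp add: rho_m1_def spec_m1_Bu_mult rho_mult m1_invariant_spec_m1)

lemma rho_m1_one: "rho_m1 (mat 1) = mat 1"
  unfolding rho_m1_def spec_m1_one by (simp add: mat3_one rho_def mat2_one)

lemma rho_m1_gens:
  "rho_m1 bs1 = mat2 1 (-1) 0 1" "rho_m1 bs2 = mat2 1 0 1 1"
  "rho_m1 bs1inv = mat2 1 1 0 1" "rho_m1 bs2inv = mat2 1 0 (-1) 1"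
  by (simp_all add: rho_m1_def spec_m1_gens rho_def)

lemma det_rho_m1: "A \<in> Bu \<Longrightarrow> det (rho_m1 A) = 1"
proof (induction A rule: Bu.induct)
  case Bu_one
  then show ?case by (simp add: rho_m1_one)
next
  case (Bu_mult A g)
  then have "det (rho_m1 g) = 1"
    by (auto simp: rho_m1_gens det_mat2)
  with Bu_mult show ?case
    by (simp add: rho_m1_mult Bu_gen det_mul)
qed

fun letter_rho :: "letter \<Rightarrow> int^2^2" where
  "letter_rho U = mat2 0 (-1) 1 0"
| "letter_rho V = mat2 0 (-1) 1 1"
| "letter_rho Vinv = mat2 1 1 (-1) 0"

fun word_rho :: "letter list \<Rightarrow> int^2^2" where
  "word_rho [] = mat 1"
| "word_rho (l # w) = letter_rho l ** word_rho w"

lemma rho_m1_letter_mat: "rho_m1 (letter_mat l) = letter_rho l"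
  by (cases l) (simp_all add: bHalf_def rho_m1_mult Bu_mult_closed Bu_gen rho_m1_gens mat2_mult)

lemma rho_m1_word_mat: "rho_m1 (word_mat w) = word_rho w"
  by (induction w) (simp_all add: rho_m1_one rho_m1_mult letter_mat_in_Bu word_mat_in_Bu rho_m1_letter_mat)

lemma rho_m1_bDelta: "rho_m1 bDelta = - mat 1"
  unfolding bDelta_eq_word_mat(1) rho_m1_word_mat by (simp add: mat2_mult mat2_one mat2_uminus)

definition eq_up_to_sign :: "'a::ring_1^'n^'m \<Rightarrow> 'a^'n^'m \<Rightarrow> bool" where
  "eq_up_to_sign M N \<longleftrightarrow> M = N \<or> M = - N"

lemma rho_m1_bDelta_pow: "eq_up_to_sign (rho_m1 (bDelta_pow k)) (mat 1)"
proof (induction k rule: int_induct[where k = 0])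
  case base
  then show ?case by (simp add: bDelta_pow_0 rho_m1_one eq_up_to_sign_def)
next
  case (step1 i)
  then show ?case
    by (auto simp: eq_up_to_sign_def bDelta_pow_succ rho_m1_mult bDelta_in_Bu bDelta_pow_in_Bu
        rho_m1_bDelta mat2_one mat2_uminus mat2_mult)
next
  case (step2 i)
  have "rho_m1 bDelta_inv ** rho_m1 bDelta = mat 1"
    using rho_m1_mult[OF bDelta_in_Bu(2,1)] by (simp add: bDelta_inverse rho_m1_one)
  moreover obtain a b c d where "rho_m1 bDelta_inv = mat2 a b c d"
    by (rule mat2_cases)
  ultimately have "rho_m1 bDelta_inv = - mat 1"
    by (simp add: rho_m1_bDelta mat2_one mat2_uminus mat2_mult mat2_eq_iff)
  with step2 show ?case
    by (auto simp: eq_up_to_sign_def bDelta_pow_pred rho_m1_mult bDelta_in_Bu bDelta_pow_in_Bu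
        mat2_one mat2_uminus mat2_mult)
qed

section \<open>Ping-pong in PSL(2, Z)\<close>

text \<open>U V and U V^-1 are sent to -[[1,1],[0,1]] and [[1,0],[1,1]], so the image of an alternating
word starting with U is, up to sign, a nonnegative matrix with positive diagonal, possibly followed
by the image of U.\<close>

definition ping_pong_form :: "int^2^2 \<Rightarrow> bool" where
  "ping_pong_form M \<longleftrightarrow> (\<exists>p q r t. 1 \<le> p \<and> 0 \<le> q \<and> 0 \<le> r \<and> 1 \<le> t \<and>
     (eq_up_to_sign M (mat2 p q r t) \<or> eq_up_to_sign M (mat2 p q r t ** letter_rho U)))"

lemma ping_pong_form_one: "ping_pong_form (mat 1)"
  unfolding ping_pong_form_def mat2_one by (intro exI[of _ 1] exI[of _ 0]) (simp add: eq_up_to_sign_def)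

lemma ping_pong_form_step:
  assumes "ping_pong_form M" "e \<noteq> U"
  shows "ping_pong_form (letter_rho U ** letter_rho e ** M)"
    and "\<not> eq_up_to_sign (letter_rho U ** letter_rho e ** M) (mat 1)"
proof -
  obtain p q r t where pos: "1 \<le> p" "0 \<le> q" "0 \<le> r" "1 \<le> t"
    and M: "eq_up_to_sign M (mat2 p q r t) \<or> eq_up_to_sign M (mat2 p q r t ** letter_rho U)"
    using assms(1) unfolding ping_pong_form_def by blast
  from assms(2) consider "e = V" | "e = Vinv"
    by (cases e) auto
  then have "\<exists>p' q' r' t'. 1 \<le> p' \<and> 0 \<le> q' \<and> 0 \<le> r' \<and> 1 \<le> t' \<and> (q' \<noteq> 0 \<or> r' \<noteq> 0) \<and>
      (eq_up_to_sign (letter_rho U ** letter_rho e ** M) (mat2 p' q' r' t') \<or>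
       eq_up_to_sign (letter_rho U ** letter_rho e ** M) (mat2 p' q' r' t' ** letter_rho U))"
  proof cases
    case 1
    show ?thesis
      using pos M unfolding 1
      by (intro exI[of _ "p + r"] exI[of _ "q + t"] exI[of _ r] exI[of _ t])
        (auto simp: eq_up_to_sign_def mat2_mult mat2_uminus mat2_eq_iff)
  next
    case 2
    show ?thesis
      using pos M unfolding 2
      by (intro exI[of _ p] exI[of _ q] exI[of _ "p + r"] exI[of _ "q + t"])
        (auto simp: eq_up_to_sign_def mat2_mult mat2_uminus mat2_eq_iff)
  qed
  then show "ping_pong_form (letter_rho U ** letter_rho e ** M)"
    and "\<not> eq_up_to_sign (letter_rho U ** letter_rho e ** M) (mat 1)"
    unfolding ping_pong_form_def
    by (auto simp: eq_up_to_sign_def mat2_one mat2_mult mat2_uminus mat2_eq_iff)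
qed

lemma ping_pong_form_V_mult_not_pm_one:
  assumes "ping_pong_form M" "e \<noteq> U"
  shows "\<not> eq_up_to_sign (letter_rho e ** M) (mat 1)"
proof -
  obtain p q r t where pos: "1 \<le> p" "0 \<le> q" "0 \<le> r" "1 \<le> t"
    and M: "eq_up_to_sign M (mat2 p q r t) \<or> eq_up_to_sign M (mat2 p q r t ** letter_rho U)"
    using assms(1) unfolding ping_pong_form_def by blast
  from assms(2) consider "e = V" | "e = Vinv"
    by (cases e) auto
  then show ?thesis
    using pos M by cases (auto simp: eq_up_to_sign_def mat2_one mat2_mult mat2_uminus mat2_eq_iff)
qed

lemma word_rho_ping_pong_form:
  "alternating w \<Longrightarrow> w = [] \<or> hd w = U \<Longrightarrow> ping_pong_form (word_rho w)"
proof (induction w rule: induct_list012)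
  case 1
  then show ?case
    by (simp add: ping_pong_form_one)
next
  case (2 x)
  then show ?case
    unfolding ping_pong_form_def mat2_one
    by (intro exI[of _ 1] exI[of _ 0]) (simp add: eq_up_to_sign_def mat2_mult)
next
  case (3 x y w)
  then have "x = U" "y \<noteq> U" "alternating w" "w = [] \<or> hd w = U"
    using alternating_Cons_hd[of y w] by (auto dest: alternating_ConsD)
  then show ?case
    using "3.IH"(1) ping_pong_form_step(1) by (simp add: matrix_mul_assoc)
qed

lemma word_rho_not_pm_one:
  assumes "alternating w" "w \<noteq> []"
  shows "\<not> eq_up_to_sign (word_rho w) (mat 1)"
proof (cases w rule: remdups_adj.cases)
  case (2 x)
  then show ?thesis
    by (cases x) (auto simp: eq_up_to_sign_def mat2_one mat2_mult mat2_uminus mat2_eq_iff)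
next
  case (3 x y w')
  show ?thesis
  proof (cases "x = U")
    case True
    with assms have "y \<noteq> U" "ping_pong_form (word_rho w')"
      unfolding 3 using word_rho_ping_pong_form alternating_Cons_hd[of y w']
      by (auto dest!: alternating_ConsD)
    then show ?thesis
      using ping_pong_form_step(2) True unfolding 3 by (simp add: matrix_mul_assoc)
  next
    case False
    with assms have "alternating (y # w')" "y # w' = [] \<or> hd (y # w') = U"
      unfolding 3 using alternating_ConsD alternating_Cons_hd by blast+
    then have "ping_pong_form (word_rho (y # w'))"
      by (rule word_rho_ping_pong_form)
    then show ?thesis
      using ping_pong_form_V_mult_not_pm_one False unfolding 3 by simp
  qed
qed (use assms in simp)

section \<open>Kernel, centre and image\<close>

lemma eq_up_to_sign_one_mult_iff:
  fixes X Y :: "'a::ring_1^'n^'n"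
  assumes "eq_up_to_sign X (mat 1)"
  shows "eq_up_to_sign (X ** Y) (mat 1) \<longleftrightarrow> eq_up_to_sign Y (mat 1)"
proof -
  have "(- A) ** B = - (A ** B)" for A B :: "'a^'n^'n"
    by (simp add: vec_eq_iff matrix_matrix_mult_def sum_negf)
  then have "(- mat 1) ** Y = - Y"
    by simp
  with assms show ?thesis
    unfolding eq_up_to_sign_def by (auto simp: minus_equation_iff[of Y])
qed

lemma rho_m1_kernel:
  assumes "A \<in> Bu" "eq_up_to_sign (rho_m1 A) (mat 1)"
  shows "A \<in> range bDelta_pow"
proof -
  obtain j w where w: "alternating w" and A: "A = bDelta_pow j ** word_mat w"
    using Bu_delta_normal_form[OF assms(1)] unfolding delta_normal_form_def by blast
  have "rho_m1 A = rho_m1 (bDelta_pow j) ** word_rho w"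
    unfolding A by (simp add: rho_m1_mult bDelta_pow_in_Bu word_mat_in_Bu rho_m1_word_mat)
  then have "eq_up_to_sign (word_rho w) (mat 1)"
    using assms(2) eq_up_to_sign_one_mult_iff[OF rho_m1_bDelta_pow] by simp
  then have "w = []"
    using word_rho_not_pm_one[OF w] by blast
  then show ?thesis
    unfolding A by simp
qed

lemma center_Bu_rho_m1:
  assumes "A \<in> center_Bu"
  shows "eq_up_to_sign (rho_m1 A) (mat 1)"
proof -
  have A: "A \<in> Bu" "A ** bs1 = bs1 ** A" "A ** bs2 = bs2 ** A"
    using assms Bu_gen unfolding center_Bu_def by auto
  obtain p q r t where M: "rho_m1 A = mat2 p q r t"
    by (rule mat2_cases)
  have "rho_m1 A ** rho_m1 bs1 = rho_m1 bs1 ** rho_m1 A" "rho_m1 A ** rho_m1 bs2 = rho_m1 bs2 ** rho_m1 A"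
    using A by (metis rho_m1_mult Bu_gen insertI1 insertI2)+
  then have "r = 0" "p = t" "q = 0"
    unfolding M rho_m1_gens by (simp_all add: mat2_mult mat2_eq_iff)
  moreover have "p * t - q * r = 1"
    using det_rho_m1[OF A(1)] by (simp add: M det_mat2)
  ultimately show ?thesis
    by (auto simp: M eq_up_to_sign_def zmult_eq_1_iff mat2_one mat2_uminus)
qed

lemma proj_eq_refl: "proj_eq M M"
  unfolding proj_eq_def by (intro exI[of _ 1]) simp

lemma proj_eq_one_iff:
  assumes "det M = 1"
  shows "proj_eq M (mat 1) \<longleftrightarrow> eq_up_to_sign M (mat 1)"
proof
  assume "proj_eq M (mat 1)"
  then obtain c :: "rat poly fract" where c: "\<And>i j. of_int (M $ i $ j) = c * of_int (mat 1 $ i $ j)"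
    unfolding proj_eq_def by blast
  obtain a b c' d where M: "M = mat2 a b c' d"
    by (rule mat2_cases)
  have "b = 0" "c' = 0" "(of_int a :: rat poly fract) = of_int d"
    using c[of 1 2] c[of 2 1] c[of 1 1] c[of 2 2] by (simp_all add: M mat_def)
  moreover have "a * d - b * c' = 1"
    using assms by (simp add: M det_mat2)
  ultimately show "eq_up_to_sign M (mat 1)"
    by (auto simp: M eq_up_to_sign_def zmult_eq_1_iff mat2_one mat2_uminus)
next
  assume "eq_up_to_sign M (mat 1)"
  then show "proj_eq M (mat 1)"
    unfolding eq_up_to_sign_def proj_eq_def
    by (elim disjE; intro exI[of _ "of_int (M $ 1 $ 1)"]) (auto simp: mat_def)
qed

lemma rho_m1_image_mult: "M \<in> rho_m1 ` Bu \<Longrightarrow> N \<in> rho_m1 ` Bu \<Longrightarrow> M ** N \<in> rho_m1 ` Bu"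
  by (auto simp flip: rho_m1_mult intro: Bu_mult_closed)

lemma unipotent_in_rho_m1_image: "mat2 1 k 0 1 \<in> rho_m1 ` Bu"
proof (induction k rule: int_induct[where k = 0])
  case base
  then show ?case
    using rho_m1_one Bu_one by (metis image_eqI mat2_one)
next
  case (step1 i)
  have "mat2 1 1 0 1 \<in> rho_m1 ` Bu"
    by (rule image_eqI[where x = bs1inv]) (simp_all add: rho_m1_gens Bu_gen)
  then have "mat2 1 1 0 1 ** mat2 1 i 0 1 \<in> rho_m1 ` Bu"
    using step1(2) by (rule rho_m1_image_mult)
  then show ?case
    by (simp add: mat2_mult add.commute)
next
  case (step2 i)
  have "mat2 1 (-1) 0 1 \<in> rho_m1 ` Bu"
    by (rule image_eqI[where x = bs1]) (simp_all add: rho_m1_gens Bu_gen)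
  then have "mat2 1 (-1) 0 1 ** mat2 1 i 0 1 \<in> rho_m1 ` Bu"
    using step2(2) by (rule rho_m1_image_mult)
  then show ?case
    by (simp add: mat2_mult)
qed

lemma SL2_in_rho_m1_image: "a * d - b * c = 1 \<Longrightarrow> mat2 a b c d \<in> rho_m1 ` Bu"
proof (induction "nat \<bar>c\<bar>" arbitrary: a b c d rule: less_induct)
  case less
  have S: "mat2 0 (-1) 1 0 \<in> rho_m1 ` Bu"
    using rho_m1_letter_mat[of U] letter_mat_in_Bu by (metis image_eqI letter_rho.simps(1))
  show ?case
  proof (cases "c = 0")
    case True
    then have "a = 1 \<and> d = 1 \<or> a = -1 \<and> d = -1"
      using less.prems by (simp add: zmult_eq_1_iff)
    then show ?thesis
    proof
      assume "a = 1 \<and> d = 1"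
      then show ?thesis
        using True unipotent_in_rho_m1_image by simp
    next
      assume "a = -1 \<and> d = -1"
      moreover have "mat2 0 (-1) 1 0 ** mat2 0 (-1) 1 0 ** mat2 1 (- b) 0 1 \<in> rho_m1 ` Bu"
        using S unipotent_in_rho_m1_image by (intro rho_m1_image_mult)
      ultimately show ?thesis
        using True by (simp add: mat2_mult)
    qed
  next
    case False
    txt \<open>With a = q c + r and |r| < |c|: mat2 a b c d = T^q S (mat2 c d (-r) (q d - b)).\<close>
    define q r where "q = a div c" and "r = a mod c"
    have a: "a = q * c + r"
      by (simp add: q_def r_def)
    have "nat \<bar>- r\<bar> < nat \<bar>c\<bar>"
      using False abs_mod_less[of c a] by (simp add: r_def)
    moreover have "c * (q * d - b) - d * (- r) = 1"
      using less.prems unfolding a by (simp add: algebra_simps)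
    ultimately have "mat2 c d (- r) (q * d - b) \<in> rho_m1 ` Bu"
      using less.hyps by blast
    then have "mat2 1 q 0 1 ** (mat2 0 (-1) 1 0 ** mat2 c d (- r) (q * d - b)) \<in> rho_m1 ` Bu"
      using S unipotent_in_rho_m1_image by (intro rho_m1_image_mult)
    then show ?thesis
      unfolding a by (simp add: mat2_mult algebra_simps)
  qed
qed

lemma rho_m1_surj: "det N = 1 \<Longrightarrow> \<exists>A \<in> Bu. rho_m1 A = N"
  using SL2_in_rho_m1_image by (metis det_mat2 image_iff mat2_cases)

lemma det_bDelta_pow: "det (bDelta_pow k) = fls_X_intpow (6 * k)"
proof -
  have X_mult: "fls_shift i 1 * fls_shift j 1 = (fls_shift (i + j) 1 :: lpoly)" for i j
    using fls_X_intpow_times_fls_X_intpow[of "- i" "- j"] by (simp add: add.commute)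
  have "det bs1 = - tL" "det bs2 = - tL" "det bs1inv = - tLinv" "det bs2inv = - tLinv"
    by (simp_all add: bs1_def bs2_def bs1inv_def bs2inv_def det_3)
  then have "det bDelta = fls_X_intpow 6" "det bDelta_inv = fls_X_intpow (-6)"
    by (simp_all add: bDelta_def bDelta_inv_def det_mul tL_eq_X_intpow X_mult)
  then show ?thesis
  proof (induction k rule: int_induct[where k = 0])
    case base
    then show ?case by (simp add: bDelta_pow_0)
  next
    case (step1 i)
    have "det (bDelta_pow (i + 1)) = det bDelta * det (bDelta_pow i)"
      by (simp only: bDelta_pow_succ det_mul)
    with step1 show ?case
      by (simp add: X_mult algebra_simps)
  next
    case (step2 i)
    have "det (bDelta_pow (i - 1)) = det bDelta_inv * det (bDelta_pow i)"
      by (simp only: bDelta_pow_pred det_mul)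
    with step2 show ?case
      by (simp add: X_mult algebra_simps)
  qed
qed

lemma inj_bDelta_pow: "inj bDelta_pow"
proof (rule injI)
  fix m n
  assume "bDelta_pow m = bDelta_pow n"
  then have "fls_subdegree (fls_X_intpow (6 * m) :: lpoly) = fls_subdegree (fls_X_intpow (6 * n) :: lpoly)"
    by (metis det_bDelta_pow)
  then show "m = n"
    by simp
qed

theorem lemma3p9:
  shows "(\<forall>A \<in> Bu. rhobar_in_PSL (rho (spec_m1 A)))
    \<and> (\<forall>N :: int^2^2. det N = 1 \<longrightarrow> (\<exists>A \<in> Bu. proj_eq (rho (spec_m1 A)) N))
    \<and> {A \<in> Bu. proj_eq (rho (spec_m1 A)) (mat 1)} = center_Bu
    \<and> center_Bu = range bDelta_pow
    \<and> inj bDelta_pow"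
proof -
  have kernel: "{A \<in> Bu. proj_eq (rho_m1 A) (mat 1)} = range bDelta_pow"
    using proj_eq_one_iff det_rho_m1 rho_m1_kernel rho_m1_bDelta_pow bDelta_pow_in_Bu by auto
  have center: "center_Bu = range bDelta_pow"
    using center_Bu_rho_m1 rho_m1_kernel bDelta_pow_in_center unfolding center_Bu_def by auto
  show ?thesis
    unfolding rho_m1_def[symmetric] rhobar_in_PSL_def kernel center
    using det_rho_m1 rho_m1_surj proj_eq_refl inj_bDelta_pow by blast
qed

end
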